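(* Let $2\leq k\leq n\in\mathbb{N}$ and let $\mathbf{X}$ be a loopless digraph. Suppose $\zeta$ is a map assigning to each $\mathbf{x}\in V(\mathbf{X})^k$ a function $\zeta(\mathbf{x}):[n]^k\to\mathbb{Z}$ such that: (i) $\sum_{\mathbf{a}\in[n]^k}\zeta(\mathbf{x})(\mathbf{a})=1$ for every $\mathbf{x}\in V(\mathbf{X})^k$; (ii) for every edge $\mathbf{y}=(y_1,y_2)\in E(\mathbf{X})$ there is an integer vector $(q_{\mathbf{b}})_{\mathbf{b}\in E(\mathbf{K}_n)}$ with $\sum_{\mathbf{b}}q_{\mathbf{b}}=1$ such that $\zeta(\mathbf{y}_{\mathbf{i}})(\mathbf{a})=\sum_{\mathbf{b}\in E(\mathbf{K}_n),\ \mathbf{b}_{\mathbf{i}}=\mathbf{a}}q_{\mathbf{b}}$ for all $\mathbf{i}\in[2]^k$ and $\mathbf{a}\in[n]^k$; (iii) $\zeta(\mathbf{x}_{\mathbf{i}})(\mathbf{a})=\sum_{\mathbf{b}\in[n]^k,\ \mathbf{b}_{\mathbf{i}}=\mathbf{a}}\zeta(\mathbf{x})(\mathbf{b})$ for all $\mathbf{x}\in V(\mathbf{X})^k$, $\mathbf{i}\in[k]^k$, $\mathbf{a}\in[n]^k$; (iv) $\zeta(\mathbf{x})(\mathbf{a})=0$ for all $\mathbf{x}\in V(\mathbf{X})^k$ and $\mathbf{a}\in[n]^k$ with $\mathbf{a}\not\prec\mathbf{x}$. Then $\mathrm{BA}^k(\mathbf{X},\mathbf{K}_n)=\textsc{Y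es}$.
   Context: Digraphs are finite; a digraph is loopless if it has no edge of the form $(x,x)$. $\mathbf{K}_n$ is the digraph with vertex set $[n]=\{1,\dots,n\}$ and edge set all pairs of distinct elements. For a tuple $\mathbf{z}=(z_1,\dots,z_m)$ and $\mathbf{i}=(i_1,\dots,i_p)\in[m]^p$, $\mathbf{z}_{\mathbf{i}}=(z_{i_1},\dots,z_{i_p})$. For tuples $\mathbf{s},\mathbf{t}$ of equal length $k$, $\mathbf{s}\prec\mathbf{t}$ means that $s_i=s_j$ implies $t_i=t_j$ for all $i,j\in[k]$; $\not\prec$ is its negation. For digraphs $\mathbf{X},\mathbf{A}$ and $k\geq 2$, take variables $\lambda_{\mathbf{x},\mathbf{a}}$ ($\mathbf{x}\in V(\mathbf{X})^k,\mathbf{a}\in V(\mathbf{A})^k$) and $\mu_{\mathbf{y},\mathbf{b}}$ ($\mathbf{y}\in E(\mathbf{X}),\mathbf{b}\in E(\mathbf{A})$) and equations: (1) $\sum_{\mathbf{a}}\lambda_{\mathbf{x},\mathbf{a}}=1$ for all $\mathbf{x}$; (2) $\sum_{\hat{\mathbf{a}}:\hat{\mathbf{a}}_{\mathbf{i}}=\mathbf{a}}\lambda_{\mathbf{x},\hat{\mathbf{a}}}=\lambda_{\mathbf{x}_{\mathbf{i}},\mathbf{a}}$ for all $\mathbf{x}\in V(\mathbf{X})^k,\mathbf{i}\in[k]^k,\mathbf{a}\in V(\mathbf{A})^k$; (3) $\sum_{\mathbf{b}\in E(\mathbf{A}):\mathbf{b}_{\mathbf{i}}=\mathbf{a}}\mu_{\mathbf{y},\mathbf{b}}=\lambda_{\mathbf{y}_{\mathbf{i}},\mathbf{a}}$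 for all $\mathbf{y}\in E(\mathbf{X}),\mathbf{i}\in[2]^k,\mathbf{a}\in V(\mathbf{A})^k$; (4) $\lambda_{\mathbf{x},\mathbf{a}}=0$ if $\mathbf{x}\not\prec\mathbf{a}$; (5) $\mu_{\mathbf{y},\mathbf{b}}=0$ if $\mathbf{y}\not\prec\mathbf{b}$. $\mathrm{BA}^k(\mathbf{X},\mathbf{A})=\textsc{Yes}$ means that this system has a nonnegative rational solution $(\lambda^{(B)},\mu^{(B)})$ and an integer solution $(\lambda^{(A)},\mu^{(A)})$ such that every variable that is $0$ in the former is $0$ in the latter. *)

theory Defs
  imports Complex_Main "HOL-Library.NList" "Graph_Theory.Pair_Digraph"
begin

text \<open>
  A tuple in \<open>S\<^sup>k\<close> is a list in \<^term>\<open>nlists k S\<close>. Positions are counted from 0, so the index set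
  \<open>[m]\<close> of an \<open>m\<close>-tuple is \<^term>\<open>{..<m}\<close>, and an index tuple in \<open>[m]\<^sup>p\<close> is a list in
  \<^term>\<open>nlists p {..<m}\<close>. The shift does not affect the vertex set of \<open>K\<^sub>n\<close>, which is \<^term>\<open>{1..n}\<close>.
\<close>

definition reindex :: "'a list \<Rightarrow> nat list \<Rightarrow> 'a list" where
  "reindex z is = map (\<lambda>j. z ! j) is"

definition tuple_prec :: "'a list \<Rightarrow> 'b list \<Rightarrow> bool" (infix \<open>\<prec>\<close> 50) where
  "s \<prec> t \<longleftrightarrow> (\<forall>i<length s. \<forall>j<length s. s ! i = s ! j \<longrightarrow> t ! i = t ! j)"

text \<open>An edge, which the digraph library represents as a pair, viewed as a tuple of length 2.\<close>

definition edge_tuple :: "'a \<times> 'a \<Rightarrow> 'a list" where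
  "edge_tuple e = [fst e, snd e]"

definition complete_loopless :: "nat \<Rightarrow> nat pair_pre_digraph" where
  "complete_loopless n = \<lparr> pverts = {1..n}, parcs = {(a, b). a \<in> {1..n} \<and> b \<in> {1..n} \<and> a \<noteq> b} \<rparr>"

text \<open>
  The variables \<open>\<lambda>\<^bsub>x,a\<^esub>\<close> and \<open>\<mu>\<^bsub>y,b\<^esub>\<close> are the values \<open>l x a\<close> and \<open>m y b\<close> with
  \<open>x \<in> V(X)\<^sup>k\<close>, \<open>a \<in> V(A)\<^sup>k\<close>, \<open>y \<in> E(X)\<close>, \<open>b \<in> E(A)\<close>; values at other arguments are never
  constrained or used.
\<close>

definition BA_system ::
  "nat \<Rightarrow> 'a pair_pre_digraph \<Rightarrow> 'b pair_pre_digraph \<Rightarrow>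
   ('a list \<Rightarrow> 'b list \<Rightarrow> 'r::comm_ring_1) \<Rightarrow> ('a \<times> 'a \<Rightarrow> 'b \<times> 'b \<Rightarrow> 'r) \<Rightarrow> bool" where
  "BA_system k X A l m \<longleftrightarrow>
     (\<forall>x \<in> nlists k (pverts X). (\<Sum>a \<in> nlists k (pverts A). l x a) = 1) \<and>
     (\<forall>x \<in> nlists k (pverts X). \<forall>is \<in> nlists k {..<k}. \<forall>a \<in> nlists k (pverts A).
        (\<Sum>a' \<in> {a' \<in> nlists k (pverts A). reindex a' is = a}. l x a') = l (reindex x is) a) \<and>
     (\<forall>y \<in> parcs X. \<forall>is \<in> nlists k {..<2}. \<forall>a \<in> nlists k (pverts A).
        (\<Sum>b \<in> {b \<in> parcs A. reindex (edge_tuple b) is = a}. m y b)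
          = l (reindex (edge_tuple y) is) a) \<and>
     (\<forall>x \<in> nlists k (pverts X). \<forall>a \<in> nlists k (pverts A). \<not> x \<prec> a \<longrightarrow> l x a = 0) \<and>
     (\<forall>y \<in> parcs X. \<forall>b \<in> parcs A. \<not> edge_tuple y \<prec> edge_tuple b \<longrightarrow> m y b = 0)"

definition BA ::
  "nat \<Rightarrow> 'a pair_pre_digraph \<Rightarrow> 'b pair_pre_digraph \<Rightarrow> bool" where
  "BA k X A \<longleftrightarrow>
     (\<exists>(lB :: 'a list \<Rightarrow> 'b list \<Rightarrow> rat) (mB :: 'a \<times> 'a \<Rightarrow> 'b \<times> 'b \<Rightarrow> rat)
       (lA :: 'a list \<Rightarrow> 'b list \<Rightarrow> int) (mA :: 'a \<times> 'a \<Rightarrow> 'b \<times> 'b \<Rightarrow> int).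
        BA_system k X A lB mB \<and>
        (\<forall>x \<in> nlists k (pverts X). \<forall>a \<in> nlists k (pverts A). 0 \<le> lB x a) \<and>
        (\<forall>y \<in> parcs X. \<forall>b \<in> parcs A. 0 \<le> mB y b) \<and>
        BA_system k X A lA mA \<and>
        (\<forall>x \<in> nlists k (pverts X). \<forall>a \<in> nlists k (pverts A). lB x a = 0 \<longrightarrow> lA x a = 0) \<and>
        (\<forall>y \<in> parcs X. \<forall>b \<in> parcs A. mB y b = 0 \<longrightarrow> mA y b = 0))"

end

theory Submission
  imports Defs "HOL-Combinatorics.Permutations"
begin

text \<open>
  Fix for each \<open>x\<close> a tuple \<open>c x\<close> over \<open>[n]\<close> with the same equality pattern as \<open>x\<close>, which exists since
  \<open>k \<le> n\<close>. Applying a uniformly random permutation of \<open>[n]\<close> to \<open>c x\<close> gives a nonnegative solution: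
  its law depends on the equality pattern only, which makes the marginals agree. It gives positive
  weight to every tuple with the equality pattern of \<open>x\<close>. By (iv), together with (iii) for the index
  tuples that duplicate an entry, \<open>\<zeta> x\<close> is supported on exactly these tuples, so \<open>\<zeta>\<close> and the vectors
  \<open>q\<close> of (ii) form a compatible integer solution.
\<close>

section \<open>Equality patterns of tuples\<close>

definition same_pattern :: "'a list \<Rightarrow> 'b list \<Rightarrow> bool" where
  "same_pattern s t \<longleftrightarrow> length s = length t \<and> s \<prec> t \<and> t \<prec> s"

lemma same_pattern_sym: "same_pattern s t \<Longrightarrow> same_pattern t s"
  by (auto simp: same_pattern_def)

lemma same_pattern_trans: "same_pattern s t \<Longrightarrow> same_pattern t u \<Longrightarrow> same_pattern s u"
  unfolding same_pattern_def tuple_prec_def by metis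

lemma same_pattern_map: "inj_on f (set s) \<Longrightarrow> same_pattern s (map f s)"
  by (auto simp: same_pattern_def tuple_prec_def inj_on_def)

lemma same_pattern_reindex:
  "same_pattern s t \<Longrightarrow> set is \<subseteq> {..<length s} \<Longrightarrow> same_pattern (reindex s is) (reindex t is)"
  by (auto simp: same_pattern_def tuple_prec_def reindex_def subset_iff)

lemma map_reindex: "set is \<subseteq> {..<length s} \<Longrightarrow> map f (reindex s is) = reindex (map f s) is"
  by (auto simp: reindex_def)

lemma reindex_in_nlists: "s \<in> nlists m A \<Longrightarrow> is \<in> nlists k {..<m} \<Longrightarrow> reindex s is \<in> nlists k A"
  unfolding nlists_def by (fastforce simp: reindex_def)

lemma finite_nlists: "finite A \<Longrightarrow> finite (nlists k A)"
  using finite_lists_length_eq[of A k] unfolding nlists_def by (simp add: conj_commute)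

lemma tuple_prec_imp_map:
  assumes "s \<prec> t" "length s = length t"
  obtains h where "map h s = t"
proof
  \<comment> \<open>By \<open>s \<prec> t\<close> the value \<open>t ! i\<close> is the same for
    every position \<open>i\<close> of \<open>y\<close> in \<open>s\<close>, so any choice works;
    off \<open>set s\<close> the value is arbitrary.\<close>
  define h where "h y = t ! (SOME i. i < length s \<and> s ! i = y)" for y
  show "map h s = t"
  proof (rule nth_equalityI)
    fix j assume j: "j < length (map h s)"
    let ?i = "SOME i. i < length s \<and> s ! i = s ! j"
    have "?i < length s \<and> s ! ?i = s ! j"
      by (rule someI[of _ j]) (use j in auto)
    then have "t ! ?i = t ! j"
      using assms(1) j unfolding tuple_prec_def length_map by blast
    then show "map h s ! j = t ! j"
      using j by (simp add: h_def)
  qed (use assms in simp)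
qed

text \<open>Matching entries position by position is a bijection from \<open>set s\<close> to
  \<open>set t\<close>; their complements in the finite set \<open>S\<close> have equal size, so it
  extends to \<open>S\<close>. Permutations of \<open>S\<close> thus act transitively on the tuples
  over \<open>S\<close> with a given pattern.\<close>

lemma same_pattern_imp_permutes:
  assumes "same_pattern s t" "finite S" "set s \<subseteq> S" "set t \<subseteq> S"
  obtains p where "p permutes S" "map p s = t"
proof -
  obtain h where h: "map h s = t"
    using assms(1) tuple_prec_imp_map by (auto simp: same_pattern_def)
  \<comment> \<open>This is the other half of the pattern, \<open>t \<prec> s\<close>.\<close>
  have inj: "inj_on h (set s)"
    using assms(1) h by (fastforce simp: inj_on_def same_pattern_def tuple_prec_def in_set_conv_nth)
  have bij_h: "bij_betw h (set s) (set t)"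
    using inj h by (auto simp: bij_betw_def)
  then have "card (S - set s) = card (S - set t)"
    using assms bij_betw_same_card[OF bij_h] by (simp add: card_Diff_subset finite_subset)
  then obtain g where bij_g: "bij_betw g (S - set s) (S - set t)"
    using assms(2) finite_same_card_bij by blast
  define p where "p x = (if x \<in> set s then h x else if x \<in> S then g x else x)" for x
  have "bij_betw p (set s) (set t)"
    using bij_h by (rule iffD1[OF bij_betw_cong, rotated]) (simp add: p_def)
  moreover have "bij_betw p (S - set s) (S - set t)"
    using bij_g by (rule iffD1[OF bij_betw_cong, rotated]) (simp add: p_def)
  ultimately have "bij_betw p (set s \<union> (S - set s)) (set t \<union> (S - set t))"
    by (rule bij_betw_combine) auto
  then have "bij_betw p S S"
    using assms by (simp add: Un_absorb1)
  moreover have "p x = x" if "x \<notin> S" for x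
    using that assms by (auto simp: p_def)
  ultimately have "p permutes S"
    by (rule bij_imp_permutes)
  moreover have "map p s = t"
    using h by (auto simp: p_def)
  ultimately show thesis ..
qed

section \<open>The law of a randomly permuted tuple\<close>

lemma sum_card_fibres:
  assumes "finite S" "finite A" "f ` S \<subseteq> A"
  shows "(\<Sum>a \<in> {a \<in> A. P a}. card {p \<in> S. f p = a}) = card {p \<in> S. P (f p)}"
proof -
  have "{p \<in> S. P (f p)} = (\<Union>a \<in> {a \<in> A. P a}. {p \<in> S. f p = a})"
    using assms(3) by auto
  moreover have "card \<dots> = (\<Sum>a \<in> {a \<in> A. P a}. card {p \<in> S. f p = a})"
    by (rule card_UN_disjoint) (use assms in auto)
  ultimately show ?thesis by simp
qed

lemma sum_card_permutes:
  assumes "finite S" "finite A" "\<And>p. p permutes S \<Longrightarrow> f p \<in> A"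
  shows "(\<Sum>a \<in> {a \<in> A. P a}. rat_of_nat (card {p. p permutes S \<and> f p = a}) / d)
           = of_nat (card {p. p permutes S \<and> P (f p)}) / d"
  using sum_card_fibres[of "{p. p permutes S}" A f P] assms finite_permutations[OF assms(1)]
  by (simp flip: sum_divide_distrib of_nat_sum) (auto simp: image_subset_iff)

text \<open>For finite \<open>S\<close>, the probability that a uniformly random permutation of
  \<open>S\<close> carries \<open>c\<close> to \<open>a\<close>.\<close>

definition perm_freq :: "'b set \<Rightarrow> 'b list \<Rightarrow> 'b list \<Rightarrow> rat" where
  "perm_freq S c a = of_nat (card {p. p permutes S \<and> map p c = a}) / fact (card S)"

lemma perm_freq_nonneg: "0 \<le> perm_freq S c a"
  by (simp add: perm_freq_def)

lemma perm_freq_nonzero_iff: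
  assumes "finite S"
  shows "perm_freq S c a \<noteq> 0 \<longleftrightarrow> (\<exists>p. p permutes S \<and> map p c = a)"
proof -
  \<comment> \<open>An infinite set has \<open>card\<close> 0, so a witness \<open>p\<close> gives a
    nonzero count only together with finiteness.\<close>
  have "finite {p. p permutes S \<and> map p c = a}"
    using finite_permutations[OF assms] by (rule rev_finite_subset) auto
  then show ?thesis by (auto simp: perm_freq_def)
qed

text \<open>If \<open>q\<close> carries \<open>c\<close> to \<open>d\<close>, then composition with
  \<open>q\<close> on the right matches the permutations carrying \<open>d\<close> to
  \<open>a\<close> with those carrying \<open>c\<close> to \<open>a\<close>.\<close>

lemma perm_freq_cong:
  assumes "finite S" "same_pattern c d" "set c \<subseteq> S" "set d \<subseteq> S"
  shows "perm_freq S c a = perm_freq S d a"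
proof -
  obtain q where q: "q permutes S" "map q c = d"
    using same_pattern_imp_permutes assms by blast
  have inv: "map (inv q) d = c"
    unfolding q(2)[symmetric] by (simp add: permutes_inv_o[OF q(1)])
  have "bij_betw (\<lambda>p. p \<circ> q) {p. p permutes S \<and> map p d = a} {p. p permutes S \<and> map p c = a}"
  proof (rule bij_betw_byWitness[where f' = "\<lambda>p. p \<circ> inv q"])
    show "\<forall>p \<in> {p. p permutes S \<and> map p d = a}. (p \<circ> q) \<circ> inv q = p"
      by (simp add: comp_assoc permutes_inv_o[OF q(1)])
    show "\<forall>p \<in> {p. p permutes S \<and> map p c = a}. (p \<circ> inv q) \<circ> q = p"
      by (simp add: comp_assoc permutes_inv_o[OF q(1)])
    show "(\<lambda>p. p \<circ> q) ` {p. p permutes S \<and> map p d = a} \<subseteq> {p. p permutes S \<and> map p c = a}"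
      using permutes_compose[OF q(1)] by (auto simp: map_map[symmetric] q(2) simp del: map_map)
    show "(\<lambda>p. p \<circ> inv q) ` {p. p permutes S \<and> map p c = a} \<subseteq> {p. p permutes S \<and> map p d = a}"
      using permutes_compose[OF permutes_inv[OF q(1)]]
      by (auto simp: map_map[symmetric] inv simp del: map_map)
  qed
  from bij_betw_same_card[OF this] show ?thesis
    by (simp add: perm_freq_def)
qed

text \<open>Applying a permutation entrywise commutes with reindexing, so a marginal of the law is
  the law of the reindexed tuple.\<close>

lemma sum_perm_freq_reindex:
  fixes c :: "'b list"
  assumes "finite S" "c \<in> nlists k S" "is \<in> nlists m {..<k}"
  shows "(\<Sum>a' \<in> {a' \<in> nlists k S. reindex a' is = a}. perm_freq S c a')
           = perm_freq S (reindex c is) a"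
proof -
  have "map p c \<in> nlists k S" if "p permutes S" for p
    using assms(2) permutes_in_image[OF that] unfolding nlists_def by auto
  then have "(\<Sum>a' \<in> {a' \<in> nlists k S. reindex a' is = a}. perm_freq S c a')
      = of_nat (card {p. p permutes S \<and> reindex (map p c) is = a}) / fact (card S)"
    unfolding perm_freq_def by (intro sum_card_permutes finite_nlists assms(1))
  moreover have "map p (reindex c is) = reindex (map p c) is" for p :: "'b \<Rightarrow> 'b"
    using assms(2,3) unfolding nlists_def by (simp add: map_reindex)
  ultimately show ?thesis
    unfolding perm_freq_def by simp
qed

lemma sum_perm_freq:
  assumes "finite S" "c \<in> nlists k S"
  shows "(\<Sum>a \<in> nlists k S. perm_freq S c a) = 1"
  \<comment> \<open>Every tuple reindexes to \<open>[]\<close> along the empty index tuple, so this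
    marginal is the total mass.\<close>
  using sum_perm_freq_reindex[OF assms, of "[]" 0 "[]"] assms(1)
  by (simp add: reindex_def perm_freq_def card_permutations)

text \<open>Permutations are injective, so the image of \<open>(1, 2)\<close> is a random arc; its
  marginals are those that the edge equations ask for.\<close>

lemma sum_perm_freq_arcs:
  assumes "2 \<le> n" "is \<in> nlists k {..<2}"
  shows "(\<Sum>b \<in> {b \<in> parcs (complete_loopless n). reindex (edge_tuple b) is = a}.
            perm_freq {1..n} [1, 2] (edge_tuple b))
           = perm_freq {1..n} (reindex [1, 2] is) a"
proof -
  have finite: "finite (parcs (complete_loopless n))"
    by (rule finite_subset[of _ "{1..n} \<times> {1..n}"]) (auto simp: complete_loopless_def)
  have arc: "(p 1, p 2) \<in> parcs (complete_loopless n)" if "p permutes {1..n}" for p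
    using permutes_in_image[OF that, of 1] permutes_in_image[OF that, of 2] assms(1)
      inj_eq[OF permutes_inj[OF that], of 1 2]
    by (simp add: complete_loopless_def)
  have arc_iff: "map p [1, 2] = edge_tuple b \<longleftrightarrow> (p 1, p 2) = b" for p :: "nat \<Rightarrow> nat" and b
    by (auto simp: edge_tuple_def)
  have arc_reindex: "map p (reindex [1, 2] is) = reindex (edge_tuple (p 1, p 2)) is" for p :: "nat \<Rightarrow> nat"
    using assms(2) unfolding nlists_def by (simp add: map_reindex edge_tuple_def numeral_2_eq_2)
  show ?thesis
    unfolding perm_freq_def arc_iff arc_reindex by (intro sum_card_permutes finite arc finite_atLeastAtMost)
qed

section \<open>Reference tuples, and the support of the given map\<close>

lemma ex_same_pattern:
  assumes "x \<in> nlists k V" "k \<le> n"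
  shows "\<exists>c \<in> nlists k {1..n}. same_pattern x c"
proof -
  \<comment> \<open>A \<open>k\<close>-tuple has at most \<open>k\<close> distinct entries, so
    \<open>k \<le> n\<close> leaves room for an injection into \<open>{1..n}\<close>.\<close>
  have "card (set x) \<le> card {1..n}"
    using assms card_length[of x] by simp
  then obtain f where f: "f ` set x \<subseteq> {1..n}" "inj_on f (set x)"
    using card_le_inj[of "set x" "{1..n}"] by auto
  have "map f x \<in> nlists k {1..n}"
    using assms f unfolding nlists_def by auto
  then show ?thesis using same_pattern_map[OF f(2)] by blast
qed

text \<open>Duplicating the entry at a position \<open>i\<close> into a position \<open>j\<close> with \<open>x\<^sub>i = x\<^sub>j\<close> does not change \<open>x\<close>.\<close>

lemma zero_of_not_tuple_prec:
  fixes \<zeta> :: "'a list \<Rightarrow> 'b list \<Rightarrow> 'r::comm_monoid_add"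
  assumes x: "x \<in> nlists k V" and a: "a \<in> nlists k A" and "\<not> x \<prec> a"
    and marginal: "\<And>is. is \<in> nlists k {..<k} \<Longrightarrow>
      \<zeta> (reindex x is) a = (\<Sum>b \<in> {b \<in> nlists k A. reindex b is = a}. \<zeta> x b)"
  shows "\<zeta> x a = 0"
proof -
  obtain i j where ij: "i < k" "j < k" "x ! i = x ! j" "a ! i \<noteq> a ! j"
    using assms(1,3) by (auto simp: tuple_prec_def)
  define js where "js = [0..<k][j := i]"
  have nth_js: "js ! m = (if m = j then i else m)" if "m < k" for m
    using that by (simp add: js_def nth_list_update)
  have length_js: "length js = k" by (simp add: js_def)
  have js: "js \<in> nlists k {..<k}"
    using ij set_update_subset_insert[of "[0..<k]" j i] unfolding js_def nlists_def by auto
  have "reindex x js = x"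
    by (rule nth_equalityI) (use x ij in \<open>auto simp: reindex_def length_js nth_js\<close>)
  \<comment> \<open>Tuples reindexed by \<open>js\<close> agree at \<open>i\<close> and
    \<open>j\<close>, but \<open>a\<close> does not.\<close>
  moreover have "{b \<in> nlists k A. reindex b js = a} = {}"
  proof -
    have "reindex b js ! i = reindex b js ! j" for b :: "'b list"
      using ij by (simp add: reindex_def length_js nth_js)
    then show ?thesis using ij(4) by auto
  qed
  ultimately show ?thesis using marginal[OF js] by (simp only: sum.empty)
qed

section \<open>The two solutions and their supports\<close>

theorem theorem2p2:
  fixes X :: "'a pair_pre_digraph" and k n :: nat
    and \<zeta> :: "'a list \<Rightarrow> nat list \<Rightarrow> int"
  assumes "2 \<le> k" and "k \<le> n"
    and "pair_fin_digraph X" and "pair_loopfree_digraph X"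
    and "\<And>x. x \<in> nlists k (pverts X) \<Longrightarrow> (\<Sum>a \<in> nlists k {1..n}. \<zeta> x a) = 1"
    and "\<And>y. y \<in> parcs X \<Longrightarrow>
      \<exists>q :: nat \<times> nat \<Rightarrow> int.
        (\<Sum>b \<in> parcs (complete_loopless n). q b) = 1 \<and>
        (\<forall>is \<in> nlists k {..<2}. \<forall>a \<in> nlists k {1..n}.
           \<zeta> (reindex (edge_tuple y) is) a
             = (\<Sum>b \<in> {b \<in> parcs (complete_loopless n). reindex (edge_tuple b) is = a}. q b))"
    and "\<And>x is a. x \<in> nlists k (pverts X) \<Longrightarrow> is \<in> nlists k {..<k} \<Longrightarrow> a \<in> nlists k {1..n} \<Longrightarrow>
      \<zeta> (reindex x is) a = (\<Sum>b \<in> {b \<in> nlists k {1..n}. reindex b is = a}. \<zeta> x b)"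
    and "\<And>x a. x \<in> nlists k (pverts X) \<Longrightarrow> a \<in> nlists k {1..n} \<Longrightarrow> \<not> a \<prec> x \<Longrightarrow> \<zeta> x a = 0"
  shows "BA k X (complete_loopless n)"
proof -
  interpret pair_loopfree_digraph X by fact
  let ?S = "{1..n}" and ?K = "complete_loopless n"
  have verts: "pverts ?K = ?S" by (simp add: complete_loopless_def)
  have tuple: "edge_tuple y \<in> nlists 2 (pverts X)" if "y \<in> parcs X" for y
    using that unfolding nlists_def by (auto simp: edge_tuple_def)
  \<comment> \<open>As \<open>X\<close> is loopless, all its arcs share the pattern of a pair of
    distinct vertices, so \<open>[1, 2]\<close> can serve as reference tuple for each of
    them.\<close>
  have pattern_arc: "same_pattern (edge_tuple y) [u, v]" if "y \<in> parcs X" "u \<noteq> v" for y and u v :: nat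
    using that pair_no_loops[OF that(1)]
    by (auto simp: same_pattern_def tuple_prec_def edge_tuple_def less_Suc_eq numeral_2_eq_2)
  have prec_arc: "edge_tuple y \<prec> edge_tuple b" if "y \<in> parcs X" "b \<in> parcs ?K" for y b
    using pattern_arc[OF that(1), of "fst b" "snd b"] that(2)
    by (auto simp: same_pattern_def complete_loopless_def edge_tuple_def)
  have perm_arc: "same_pattern [1::nat, 2] (edge_tuple b)" "set (edge_tuple b) \<subseteq> ?S"
    if "b \<in> parcs ?K" for b
    using that
    by (auto simp: same_pattern_def tuple_prec_def edge_tuple_def less_Suc_eq numeral_2_eq_2
        complete_loopless_def)

  obtain c where c: "c x \<in> nlists k ?S" "same_pattern x (c x)" if "x \<in> nlists k (pverts X)" for x
    using ex_same_pattern[OF _ \<open>k \<le> n\<close>] by metis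
  define lB where "lB x = perm_freq ?S (c x)" for x
  define mB :: "'a \<times> 'a \<Rightarrow> nat \<times> nat \<Rightarrow> rat"
    where "mB y b = perm_freq ?S [1, 2] (edge_tuple b)" for y b

  \<comment> \<open>The choices \<open>c x\<close> and \<open>c (reindex x is)\<close> are
    unrelated, but only their patterns matter. Length \<open>m\<close> is \<open>k\<close> for the
    marginals of tuples and 2 for those of arcs.\<close>
  have lB_eq: "lB (reindex x is) a = perm_freq ?S (reindex d is) a"
    if "x \<in> nlists m (pverts X)" "is \<in> nlists k {..<m}" "d \<in> nlists m ?S" "same_pattern x d"
    for x m "is" d a
  proof -
    have x: "reindex x is \<in> nlists k (pverts X)"
      using that reindex_in_nlists by blast
    have "same_pattern (reindex x is) (reindex d is)"
      using that unfolding nlists_def by (auto intro: same_pattern_reindex)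
    then have "same_pattern (c (reindex x is)) (reindex d is)"
      using c(2)[OF x] same_pattern_sym same_pattern_trans by blast
    then show ?thesis
      unfolding lB_def using c(1)[OF x] reindex_in_nlists[OF that(3,2)]
      by (intro perm_freq_cong) (auto dest: nlistsE_set)
  qed

  have sysB: "BA_system k X ?K lB mB"
    unfolding BA_system_def verts
  proof (intro conjI ballI impI)
    fix x assume x: "x \<in> nlists k (pverts X)"
    show "(\<Sum>a \<in> nlists k ?S. lB x a) = 1"
      unfolding lB_def using c(1)[OF x] by (simp add: sum_perm_freq)
    fix a :: "nat list"
    show "(\<Sum>a' \<in> {a' \<in> nlists k ?S. reindex a' is = a}. lB x a') = lB (reindex x is) a"
      if "is \<in> nlists k {..<k}" for "is"
      using lB_eq[OF x that c[OF x]] sum_perm_freq_reindex[OF _ c(1)[OF x] that]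
      by (simp add: lB_def[of x])
    show "lB x a = 0" if "\<not> x \<prec> a"
    proof (rule ccontr)
      assume "lB x a \<noteq> 0"
      then obtain p where p: "p permutes ?S" "map p (c x) = a"
        unfolding lB_def using perm_freq_nonzero_iff[of ?S] by auto
      then have "x \<prec> a"
        using same_pattern_trans[OF c(2)[OF x]
            same_pattern_map[OF inj_on_subset[OF permutes_inj[OF p(1)]]]] p(2)
        by (auto simp: same_pattern_def)
      with that show False ..
    qed
  next
    fix y and "is" a :: "nat list"
    assume y: "y \<in> parcs X" and "is": "is \<in> nlists k {..<2}"
    have "[1, 2] \<in> nlists 2 ?S"
      using assms(1,2) unfolding nlists_def by auto
    then show "(\<Sum>b \<in> {b \<in> parcs ?K. reindex (edge_tuple b) is = a}. mB y b)
        = lB (reindex (edge_tuple y) is) a"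
      unfolding mB_def using lB_eq[OF tuple[OF y] "is", of "[1, 2]"] pattern_arc[OF y, of 1 2]
        sum_perm_freq_arcs[OF _ "is", of n] assms(1,2) by simp
  qed (use prec_arc in blast)

  have "\<forall>y \<in> parcs X. \<exists>q :: nat \<times> nat \<Rightarrow> int. \<forall>is \<in> nlists k {..<2}. \<forall>a \<in> nlists k ?S.
      \<zeta> (reindex (edge_tuple y) is) a
        = (\<Sum>b \<in> {b \<in> parcs ?K. reindex (edge_tuple b) is = a}. q b)"
    using assms(6) by blast
  then obtain q :: "'a \<times> 'a \<Rightarrow> nat \<times> nat \<Rightarrow> int" where
    q: "\<forall>y \<in> parcs X. \<forall>is \<in> nlists k {..<2}. \<forall>a \<in> nlists k ?S.
      \<zeta> (reindex (edge_tuple y) is) a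
        = (\<Sum>b \<in> {b \<in> parcs ?K. reindex (edge_tuple b) is = a}. q y b)"
    by (rule bchoice[THEN exE])
  \<comment> \<open>The system needs vanishing when \<open>x \<prec> a\<close> fails, the reverse of
    (iv); it comes from the marginals (iii).\<close>
  have prec: "\<zeta> x a = 0" if "x \<in> nlists k (pverts X)" "a \<in> nlists k ?S" "\<not> x \<prec> a" for x a
    using that assms(7)[OF that(1) _ that(2)] by (rule zero_of_not_tuple_prec)
  have sysA: "BA_system k X ?K \<zeta> q"
    unfolding BA_system_def verts
  proof (intro conjI ballI impI)
    show "(\<Sum>a \<in> nlists k ?S. \<zeta> x a) = 1" if "x \<in> nlists k (pverts X)" for x
      using that by (rule assms(5))
    show "(\<Sum>a' \<in> {a' \<in> nlists k ?S. reindex a' is = a}. \<zeta> x a') = \<zeta> (reindex x is) a"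
      if "x \<in> nlists k (pverts X)" "is \<in> nlists k {..<k}" "a \<in> nlists k ?S" for x "is" a
      using assms(7)[OF that] by (rule sym)
    show "(\<Sum>b \<in> {b \<in> parcs ?K. reindex (edge_tuple b) is = a}. q y b)
        = \<zeta> (reindex (edge_tuple y) is) a"
      if "y \<in> parcs X" "is \<in> nlists k {..<2}" "a \<in> nlists k ?S" for y "is" a
      using q that by simp
    show "\<zeta> x a = 0" if "x \<in> nlists k (pverts X)" "a \<in> nlists k ?S" "\<not> x \<prec> a" for x a
      using that by (rule prec)
  qed (use prec_arc in blast)

  \<comment> \<open>A nonzero \<open>\<zeta> x a\<close> forces \<open>a\<close> to have the pattern
    of \<open>x\<close>, hence to be a permuted copy of \<open>c x\<close>, which has positive
    probability.\<close>
  have suppl: "\<zeta> x a = 0"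
    if x: "x \<in> nlists k (pverts X)" and a: "a \<in> nlists k ?S" and "lB x a = 0" for x a
  proof (rule ccontr)
    assume "\<zeta> x a \<noteq> 0"
    then have "same_pattern x a"
      using x a prec assms(8) by (auto simp: same_pattern_def)
    then have "same_pattern (c x) a"
      using c(2)[OF x] same_pattern_sym same_pattern_trans by blast
    then obtain p where "p permutes ?S" "map p (c x) = a"
      using same_pattern_imp_permutes[of "c x" a ?S] nlistsE_set[OF c(1)[OF x]] nlistsE_set[OF a]
      by auto
    then have "lB x a \<noteq> 0"
      unfolding lB_def using perm_freq_nonzero_iff[of ?S] by blast
    with \<open>lB x a = 0\<close> show False by simp
  qed
  \<comment> \<open>Some permutation carries \<open>(1, 2)\<close> to any given arc, so
    \<open>mB\<close> has full support and leaves \<open>q\<close> unrestricted.\<close>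
  have suppm: "mB y b \<noteq> 0" if b: "b \<in> parcs ?K" for y b
  proof -
    have "set [1, 2] \<subseteq> ?S" using assms(1,2) by auto
    then obtain p where "p permutes ?S" "map p [1, 2] = edge_tuple b"
      using same_pattern_imp_permutes[OF perm_arc(1)[OF b] _ _ perm_arc(2)[OF b]] by auto
    then show ?thesis
      unfolding mB_def using perm_freq_nonzero_iff[of ?S] by blast
  qed
  show ?thesis
    unfolding BA_def
  proof (intro exI conjI ballI impI)
    show "BA_system k X ?K lB mB" "BA_system k X ?K \<zeta> q" by fact+
    show "0 \<le> lB x a" "0 \<le> mB y b" for x a y b
      by (simp_all add: lB_def mB_def perm_freq_nonneg)
  qed (use suppl suppm verts in auto)
qed

end
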